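(* For every punctual equivalence relation of the form $R_Y$ with $Y\subseteq\omega$ primitive recursive, there is a primitive recursive $X\subseteq\omega$ such that $R_X$ is punctual, $R_X<_{pr}R_Y$, and $(X,Y)$ does not have the black-lozenge property.
   Context: A punctual equivalence relation is a primitive recursive equivalence relation with domain $\omega$ having infinitely many equivalence classes. For equivalence relations $R,S$ on $\omega$, $R\leq_{pr} S$ means that there is a primitive recursive function $f:\omega\to\omega$ such that for all $x,y\in\omega$, $x\mathrel{R}y \Leftrightarrow f(x)\mathrel{S}f(y)$; $R<_{pr}S$ means $R\leq_{pr}S$ and $S\not\leq_{pr}R$; $R\equiv_{pr}S$ means $R\leq_{pr}S$ and $S\leq_{pr}R$. For $X\subseteq\omega$, $R_X$ is given by $x\mathrel{R_X}y \Leftrightarrow (x,y\in X \text{ or } x=y)$. For a set $U$ let $\#(0^U)[s]$ be the number of $i\leq s$ with $i\notin U$. A pair $(X,Y)$ of coinfinite primitive recursive sets has the black-lozenge property if there are (infinite and coinfinite) primitive recursive sets $X^*,Y^*$ with $R_{X^*}\equiv_{pr}R_X$, $R_{Y^*}\equiv_{pr}R_Y$ and $(\forall s)(\exists t\geq s)\,[\#(0^{X^*})[t]=\#(0^{Y^*})[t]]$. *)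

theory Defs
  imports Main
begin

text \<open>
  An \<open>n\<close>-ary function on the naturals is represented by a function on lists, of which only the
  values on lists of length \<open>n\<close> are meaningful.  The clauses only specify representatives, so
  primitive recursiveness of a function of fixed arity is defined below by agreement with such a
  representative on lists of the right length.  In clause \<open>prec\<close> the recursion argument is the
  head of the list, and the step function receives the recursion index, the previous value and
  the parameters.
\<close>

inductive prim_rec :: "nat \<Rightarrow> (nat list \<Rightarrow> nat) \<Rightarrow> bool" where
  zero: "prim_rec n (\<lambda>_. 0)"
| succ: "prim_rec 1 (\<lambda>xs. Suc (xs ! 0))"
| proj: "i < n \<Longrightarrow> prim_rec n (\<lambda>xs. xs ! i)"
| comp: "prim_rec (length fs) g \<Longrightarrow> \<forall>f \<in> set fs. prim_rec n f
    \<Longrightarrow> prim_rec n (\<lambda>xs. g (map (\<lambda>f. f xs) fs))"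
| prec: "prim_rec n g \<Longrightarrow> prim_rec (n + 2) h
    \<Longrightarrow> prim_rec (n + 1)
          (\<lambda>xs. rec_nat (g (tl xs)) (\<lambda>k r. h (k # r # tl xs)) (hd xs))"

definition prim_rec_fun :: "(nat \<Rightarrow> nat) \<Rightarrow> bool" where
  "prim_rec_fun f \<longleftrightarrow> (\<exists>g. prim_rec 1 g \<and> (\<forall>x. g [x] = f x))"

definition prim_rec_set :: "nat set \<Rightarrow> bool" where
  "prim_rec_set A \<longleftrightarrow> prim_rec_fun (\<lambda>x. if x \<in> A then 1 else 0)"

definition prim_rec_rel :: "nat rel \<Rightarrow> bool" where
  "prim_rec_rel R \<longleftrightarrow>
    (\<exists>g. prim_rec 2 g \<and> (\<forall>x y. g [x, y] = (if (x, y) \<in> R then 1 else 0)))"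

definition punctual :: "nat rel \<Rightarrow> bool" where
  "punctual R \<longleftrightarrow> equiv UNIV R \<and> prim_rec_rel R \<and> infinite (UNIV // R)"

definition pr_le :: "nat rel \<Rightarrow> nat rel \<Rightarrow> bool"  (infix "\<le>pr" 50) where
  "R \<le>pr S \<longleftrightarrow> (\<exists>f. prim_rec_fun f \<and> (\<forall>x y. (x, y) \<in> R \<longleftrightarrow> (f x, f y) \<in> S))"

definition pr_less :: "nat rel \<Rightarrow> nat rel \<Rightarrow> bool"  (infix "<pr" 50) where
  "R <pr S \<longleftrightarrow> R \<le>pr S \<and> \<not> S \<le>pr R"

definition pr_equiv :: "nat rel \<Rightarrow> nat rel \<Rightarrow> bool"  (infix "\<equiv>pr" 50) where
  "R \<equiv>pr S \<longleftrightarrow> R \<le>pr S \<and> S \<le>pr R"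

definition one_class_rel :: "nat set \<Rightarrow> nat rel" where
  "one_class_rel X = {(x, y). x \<in> X \<and> y \<in> X \<or> x = y}"

definition count_zeros :: "nat set \<Rightarrow> nat \<Rightarrow> nat" where
  "count_zeros U s = card {i. i \<le> s \<and> i \<notin> U}"

text \<open>
  The black-lozenge property is a property of pairs of coinfinite primitive recursive sets.
  These standing assumptions on \<open>X\<close> and \<open>Y\<close> are not part of the definition, so that its negation
  denies exactly the existence of \<open>X'\<close> and \<open>Y'\<close>.
\<close>

definition black_lozenge :: "nat set \<Rightarrow> nat set \<Rightarrow> bool" where
  "black_lozenge X Y \<longleftrightarrow>
    (\<exists>X' Y'. prim_rec_set X' \<and> infinite X' \<and> infinite (- X') \<and>
             prim_rec_set Y' \<and> infinite Y' \<and> infinite (- Y') \<and>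
             one_class_rel X' \<equiv>pr one_class_rel X \<and>
             one_class_rel Y' \<equiv>pr one_class_rel Y \<and>
             (\<forall>s. \<exists>t\<ge>s. count_zeros X' t = count_zeros Y' t))"

end

theory Submission imports Defs begin

text \<open>
  Call a number outside \<open>U\<close> a zero of \<open>U\<close>. What matters about \<open>R\<^sub>U\<close> is how fast its zeros come:
  a reduction \<open>f\<close> of \<open>R\<^sub>U\<close> to \<open>R\<^sub>V\<close> is injective on the zeros of \<open>U\<close> and sends at most one of them
  into \<open>V\<close>, so up to an error of one, \<open>V\<close> has at least as many zeros up to \<open>max f(0), \<dots>, f(s)\<close> as
  \<open>U\<close> has up to \<open>s\<close> (\<open>pr_le_count_zeros\<close>). It is therefore enough to make the zeros of \<open>X\<close> so rare
  that no primitive recursive change of the time scale can compensate for it.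

  Suppose that \<open>a\<close> is strictly increasing, eventually exceeds every primitive recursive function,
  and has a range that is primitive recursive together with the inverse of \<open>a\<close> on it. Let the zeros
  of \<open>X\<close> be the values \<open>a u\<close> at every other zero \<open>u\<close> of \<open>Y\<close>. Sending \<open>a u\<close> to \<open>u\<close>, and all of \<open>X\<close> to
  one of the zeros of \<open>Y\<close> that were left out, reduces \<open>R\<^sub>X\<close> to \<open>R\<^sub>Y\<close> (\<open>sparse_pr_le\<close>). For every
  primitive recursive \<open>p\<close> and all large \<open>u\<close> the value \<open>p u\<close> is less than \<open>a (u + 1)\<close>, so up to \<open>p u\<close>
  the set \<open>X\<close> has at most half as many zeros as \<open>Y\<close> has up to \<open>u\<close> (\<open>sparse_count_zeros_fast\<close>). Since
  a half falls behind by more than any constant, this excludes a reduction of \<open>R\<^sub>Y\<close> to \<open>R\<^sub>X\<close>. It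
  also excludes the black-lozenge property: replacing \<open>X\<close> and \<open>Y\<close> by equivalent sets only changes the
  time scales primitive recursively and the counts by at most one, so the two counts differ at all
  large times.

  The sequence \<open>a\<close> comes from a variant \<open>fast\<close> of the Ackermann hierarchy, whose levels bound all
  primitive recursive functions (\<open>prim_rec_fast_bounded\<close>). To obtain a diagonal of the hierarchy with
  a primitive recursive range, its evaluation is carried out in real time by a stack machine whose
  state at time \<open>t\<close> is a primitive recursive function of \<open>t\<close>. The machine starts a new evaluation
  whenever its stack is empty, and \<open>a u\<close> is the time at which this happens for the \<open>u\<close>-th time,
  counting from zero.
\<close>

section \<open>Closure properties of the primitive recursive functions\<close>

text \<open>
  The clauses of \<open>prim_rec\<close> produce particular representatives, with accidental values on lists of
  the wrong length. Identifying functions that agree on lists of length \<open>n\<close> allows a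
  primitive recursive function to be given by any convenient term.
\<close>

definition prim_rec_on :: "nat \<Rightarrow> (nat list \<Rightarrow> nat) \<Rightarrow> bool" where
  "prim_rec_on n f \<longleftrightarrow> (\<exists>g. prim_rec n g \<and> (\<forall>xs. length xs = n \<longrightarrow> g xs = f xs))"

abbreviation prim_rec1 :: "(nat \<Rightarrow> nat) \<Rightarrow> bool" where
  "prim_rec1 f \<equiv> prim_rec_on 1 (\<lambda>xs. f (xs ! 0))"

abbreviation prim_rec2 :: "(nat \<Rightarrow> nat \<Rightarrow> nat) \<Rightarrow> bool" where
  "prim_rec2 f \<equiv> prim_rec_on 2 (\<lambda>xs. f (xs ! 0) (xs ! 1))"

abbreviation prim_rec3 :: "(nat \<Rightarrow> nat \<Rightarrow> nat \<Rightarrow> nat) \<Rightarrow> bool" where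
  "prim_rec3 f \<equiv> prim_rec_on 3 (\<lambda>xs. f (xs ! 0) (xs ! 1) (xs ! 2))"

lemma prim_rec_onI: "prim_rec n f \<Longrightarrow> prim_rec_on n f"
  unfolding prim_rec_on_def by blast

lemma prim_rec_on_cong:
  assumes "prim_rec_on n f" "\<And>xs. length xs = n \<Longrightarrow> f xs = g xs"
  shows "prim_rec_on n g"
  using assms unfolding prim_rec_on_def by metis

lemma prim_rec_fun_iff: "prim_rec_fun f \<longleftrightarrow> prim_rec1 f"
proof
  assume "prim_rec_fun f"
  then obtain g where g: "prim_rec 1 g" "\<And>x. g [x] = f x"
    unfolding prim_rec_fun_def by blast
  then show "prim_rec1 f"
    unfolding prim_rec_on_def by (intro exI[of _ g]) (auto simp: length_Suc_conv)
next
  assume "prim_rec1 f"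
  then show "prim_rec_fun f"
    unfolding prim_rec_on_def prim_rec_fun_def by fastforce
qed

lemma prim_rec_set_iff: "prim_rec_set A \<longleftrightarrow> prim_rec1 (\<lambda>x. of_bool (x \<in> A))"
  unfolding prim_rec_set_def prim_rec_fun_iff of_bool_def ..

lemma prim_rec_on_nth: "i < n \<Longrightarrow> prim_rec_on n (\<lambda>xs. xs ! i)"
  by (intro prim_rec_onI prim_rec.proj)

lemma prim_rec_on_compose1:
  assumes "prim_rec1 g" "prim_rec_on n a"
  shows "prim_rec_on n (\<lambda>xs. g (a xs))"
proof -
  obtain g' where g': "prim_rec 1 g'" "\<And>xs. length xs = 1 \<Longrightarrow> g' xs = g (xs ! 0)"
    using assms(1) unfolding prim_rec_on_def by blast
  obtain a' where a': "prim_rec n a'" "\<And>xs. length xs = n \<Longrightarrow> a' xs = a xs"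
    using assms(2) unfolding prim_rec_on_def by blast
  have "prim_rec n (\<lambda>xs. g' (map (\<lambda>f. f xs) [a']))"
    using g'(1) a'(1) by (intro prim_rec.comp) auto
  then show ?thesis
    unfolding prim_rec_on_def using g'(2) a'(2) by fastforce
qed

lemma prim_rec_on_compose2:
  assumes "prim_rec2 g" "prim_rec_on n a" "prim_rec_on n b"
  shows "prim_rec_on n (\<lambda>xs. g (a xs) (b xs))"
proof -
  obtain g' where g': "prim_rec 2 g'" "\<And>xs. length xs = 2 \<Longrightarrow> g' xs = g (xs ! 0) (xs ! 1)"
    using assms(1) unfolding prim_rec_on_def by blast
  obtain a' where a': "prim_rec n a'" "\<And>xs. length xs = n \<Longrightarrow> a' xs = a xs"
    using assms(2) unfolding prim_rec_on_def by blast
  obtain b' where b': "prim_rec n b'" "\<And>xs. length xs = n \<Longrightarrow> b' xs = b xs"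
    using assms(3) unfolding prim_rec_on_def by blast
  have "prim_rec n (\<lambda>xs. g' (map (\<lambda>f. f xs) [a', b']))"
    using g'(1) a'(1) b'(1) by (intro prim_rec.comp) (auto simp: numeral_2_eq_2)
  then show ?thesis
    unfolding prim_rec_on_def using g'(2) a'(2) b'(2) by fastforce
qed

lemma prim_rec_on_compose3:
  assumes "prim_rec3 g" "prim_rec_on n a" "prim_rec_on n b" "prim_rec_on n c"
  shows "prim_rec_on n (\<lambda>xs. g (a xs) (b xs) (c xs))"
proof -
  obtain g' where g': "prim_rec 3 g'"
      "\<And>xs. length xs = 3 \<Longrightarrow> g' xs = g (xs ! 0) (xs ! 1) (xs ! 2)"
    using assms(1) unfolding prim_rec_on_def by blast
  obtain a' where a': "prim_rec n a'" "\<And>xs. length xs = n \<Longrightarrow> a' xs = a xs"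
    using assms(2) unfolding prim_rec_on_def by blast
  obtain b' where b': "prim_rec n b'" "\<And>xs. length xs = n \<Longrightarrow> b' xs = b xs"
    using assms(3) unfolding prim_rec_on_def by blast
  obtain c' where c': "prim_rec n c'" "\<And>xs. length xs = n \<Longrightarrow> c' xs = c xs"
    using assms(4) unfolding prim_rec_on_def by blast
  have "prim_rec n (\<lambda>xs. g' (map (\<lambda>f. f xs) [a', b', c']))"
    using g'(1) a'(1) b'(1) c'(1) by (intro prim_rec.comp) (auto simp: numeral_3_eq_3)
  then show ?thesis
    unfolding prim_rec_on_def using g'(2) a'(2) b'(2) c'(2) by fastforce
qed

lemma prim_rec_on_Suc:
  assumes "prim_rec_on n a"
  shows "prim_rec_on n (\<lambda>xs. Suc (a xs))"
  using prim_rec_onI[OF prim_rec.succ] assms by (rule prim_rec_on_compose1)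

lemma prim_rec_on_const: "prim_rec_on n (\<lambda>_. c)"
  by (induction c) (auto intro: prim_rec_onI prim_rec.zero prim_rec_on_Suc)

lemma prim_rec_on_rec_nat:
  assumes "prim_rec_on n b" "prim_rec_on (n + 2) h"
  shows "prim_rec_on (n + 1)
    (\<lambda>xs. rec_nat (b (tl xs)) (\<lambda>k r. h (k # r # tl xs)) (hd xs))"
proof -
  obtain b' where b': "prim_rec n b'" "\<And>xs. length xs = n \<Longrightarrow> b' xs = b xs"
    using assms(1) unfolding prim_rec_on_def by blast
  obtain h' where h': "prim_rec (n + 2) h'" "\<And>xs. length xs = n + 2 \<Longrightarrow> h' xs = h xs"
    using assms(2) unfolding prim_rec_on_def by blast
  show ?thesis
    using prim_rec_onI[OF prim_rec.prec[OF b'(1) h'(1)]]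
    by (rule prim_rec_on_cong) (simp add: b'(2) h'(2))
qed

lemma prim_rec1_rec_nat:
  assumes "prim_rec2 h"
  shows "prim_rec1 (rec_nat b h)"
proof -
  have "prim_rec_on (0 + 1) (\<lambda>xs. rec_nat b
      (\<lambda>k r. h ((k # r # tl xs) ! 0) ((k # r # tl xs) ! 1)) (hd xs))"
    using assms by (intro prim_rec_on_rec_nat prim_rec_on_const) (simp add: numeral_2_eq_2)
  then have "prim_rec_on 1 (\<lambda>xs. rec_nat b
      (\<lambda>k r. h ((k # r # tl xs) ! 0) ((k # r # tl xs) ! 1)) (hd xs))"
    by simp
  then show ?thesis
    by (rule prim_rec_on_cong) (auto simp: length_Suc_conv)
qed

lemma prim_rec2_rec_nat:
  assumes "prim_rec1 b" "prim_rec3 h"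
  shows "prim_rec2 (\<lambda>x y. rec_nat (b y) (\<lambda>k r. h k r y) x)"
proof -
  have "prim_rec_on (1 + 1) (\<lambda>xs. rec_nat (b (tl xs ! 0))
      (\<lambda>k r. h ((k # r # tl xs) ! 0) ((k # r # tl xs) ! 1) ((k # r # tl xs) ! 2)) (hd xs))"
    using assms by (intro prim_rec_on_rec_nat) (simp_all add: numeral_3_eq_3)
  then have "prim_rec_on 2 (\<lambda>xs. rec_nat (b (tl xs ! 0))
      (\<lambda>k r. h ((k # r # tl xs) ! 0) ((k # r # tl xs) ! 1) ((k # r # tl xs) ! 2)) (hd xs))"
    by (simp add: numeral_2_eq_2)
  then show ?thesis
    by (rule prim_rec_on_cong) (auto simp: length_Suc_conv numeral_2_eq_2)
qed

lemma prim_rec3_rec_nat: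
  assumes "prim_rec2 b" "prim_rec_on 4 (\<lambda>xs. h (xs ! 0) (xs ! 1) (xs ! 2) (xs ! 3))"
  shows "prim_rec3 (\<lambda>x y z. rec_nat (b y z) (\<lambda>k r. h k r y z) x)"
proof -
  have "prim_rec_on (2 + 1) (\<lambda>xs. rec_nat (b (tl xs ! 0) (tl xs ! 1))
      (\<lambda>k r. h ((k # r # tl xs) ! 0) ((k # r # tl xs) ! 1) ((k # r # tl xs) ! 2)
        ((k # r # tl xs) ! 3)) (hd xs))"
    using assms by (intro prim_rec_on_rec_nat) simp_all
  then have "prim_rec_on 3 (\<lambda>xs. rec_nat (b (tl xs ! 0) (tl xs ! 1))
      (\<lambda>k r. h ((k # r # tl xs) ! 0) ((k # r # tl xs) ! 1) ((k # r # tl xs) ! 2)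
        ((k # r # tl xs) ! 3)) (hd xs))"
    by simp
  then show ?thesis
    by (rule prim_rec_on_cong) (auto simp: length_Suc_conv numeral_2_eq_2 numeral_3_eq_3)
qed

lemmas prim_rec_on_intros =
  prim_rec_on_nth prim_rec_on_const prim_rec_on_Suc

lemma prim_rec_on_add:
  assumes "prim_rec_on n a" "prim_rec_on n b"
  shows "prim_rec_on n (\<lambda>xs. a xs + b xs)"
proof -
  have "prim_rec2 (\<lambda>x y. rec_nat y (\<lambda>k r. Suc r) x)"
    by (intro prim_rec2_rec_nat prim_rec_on_intros) simp_all
  moreover have "rec_nat y (\<lambda>k r. Suc r) x = x + y" for x y :: nat
    by (induction x) simp_all
  ultimately have "prim_rec2 (+)" by simp
  then show ?thesis using assms by (rule prim_rec_on_compose2)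
qed

lemma prim_rec_on_diff:
  assumes "prim_rec_on n a" "prim_rec_on n b"
  shows "prim_rec_on n (\<lambda>xs. a xs - b xs)"
proof -
  have "prim_rec1 (rec_nat 0 (\<lambda>k r. k))"
    by (intro prim_rec1_rec_nat prim_rec_on_intros) simp
  moreover have "rec_nat 0 (\<lambda>k r. k) x = x - 1" for x :: nat
    by (cases x) simp_all
  ultimately have pred: "prim_rec1 (\<lambda>x. x - 1)" by simp
  have "prim_rec2 (\<lambda>x y. rec_nat y (\<lambda>k r. r - 1) x)"
    by (intro prim_rec2_rec_nat prim_rec_on_intros prim_rec_on_compose1[OF pred]) simp_all
  moreover have "rec_nat y (\<lambda>k r. r - 1) x = y - x" for x y :: nat
    by (induction x) simp_all
  ultimately have "prim_rec2 (\<lambda>x y. y - x)" by simp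
  then show ?thesis using assms(2,1) by (rule prim_rec_on_compose2)
qed

lemma prim_rec_on_mult:
  assumes "prim_rec_on n a" "prim_rec_on n b"
  shows "prim_rec_on n (\<lambda>xs. a xs * b xs)"
proof -
  have "prim_rec2 (\<lambda>x y. rec_nat 0 (\<lambda>k r. r + y) x)"
    by (intro prim_rec2_rec_nat prim_rec_on_intros prim_rec_on_add) simp_all
  moreover have "rec_nat 0 (\<lambda>k r. r + y) x = x * y" for x y :: nat
    by (induction x) simp_all
  ultimately have "prim_rec2 (*)" by simp
  then show ?thesis using assms by (rule prim_rec_on_compose2)
qed

lemma prim_rec_on_not:
  assumes "prim_rec_on n (\<lambda>xs. of_bool (P xs))"
  shows "prim_rec_on n (\<lambda>xs. of_bool (\<not> P xs))"
  using prim_rec_on_diff[OF prim_rec_on_const[of n 1] assms]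
  by (rule prim_rec_on_cong) simp

lemma prim_rec_on_conj:
  assumes "prim_rec_on n (\<lambda>xs. of_bool (P xs))" "prim_rec_on n (\<lambda>xs. of_bool (Q xs))"
  shows "prim_rec_on n (\<lambda>xs. of_bool (P xs \<and> Q xs))"
  using prim_rec_on_mult[OF assms] by (rule prim_rec_on_cong) simp

lemma prim_rec_on_disj:
  assumes "prim_rec_on n (\<lambda>xs. of_bool (P xs))" "prim_rec_on n (\<lambda>xs. of_bool (Q xs))"
  shows "prim_rec_on n (\<lambda>xs. of_bool (P xs \<or> Q xs))"
  using prim_rec_on_not[OF prim_rec_on_conj[OF assms[THEN prim_rec_on_not]]] by simp

lemma prim_rec_on_eq:
  assumes "prim_rec_on n a" "prim_rec_on n b"
  shows "prim_rec_on n (\<lambda>xs. of_bool (a xs = b xs))"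
proof -
  have "prim_rec_on n (\<lambda>xs. 1 - ((a xs - b xs) + (b xs - a xs)))"
    using assms by (intro prim_rec_on_diff prim_rec_on_add prim_rec_on_const)
  then show ?thesis by (rule prim_rec_on_cong) auto
qed

lemma prim_rec_on_if:
  assumes "prim_rec_on n (\<lambda>xs. of_bool (P xs))" "prim_rec_on n a" "prim_rec_on n b"
  shows "prim_rec_on n (\<lambda>xs. if P xs then a xs else b xs)"
proof -
  have "prim_rec_on n (\<lambda>xs. of_bool (P xs) * a xs + of_bool (\<not> P xs) * b xs)"
    using assms by (intro prim_rec_on_add prim_rec_on_mult prim_rec_on_not)
  then show ?thesis by (rule prim_rec_on_cong) simp
qed

lemmas prim_rec_on_arith = prim_rec_on_intros prim_rec_on_add prim_rec_on_diff prim_rec_on_mult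
  prim_rec_on_not prim_rec_on_conj prim_rec_on_disj prim_rec_on_eq prim_rec_on_if

lemma prim_rec2_sum:
  assumes "prim_rec2 f"
  shows "prim_rec2 (\<lambda>x y. \<Sum>j<x. f j y)"
proof -
  have "prim_rec2 (\<lambda>x y. rec_nat 0 (\<lambda>k r. r + f k y) x)"
    by (intro prim_rec2_rec_nat prim_rec_on_arith prim_rec_on_compose2[OF assms]) simp_all
  moreover have "rec_nat 0 (\<lambda>k r. r + f k y) x = (\<Sum>j<x. f j y)" for x y :: nat
    by (induction x) simp_all
  ultimately show ?thesis by simp
qed

lemma prim_rec_on_sum:
  assumes "prim_rec1 f" "prim_rec_on n a"
  shows "prim_rec_on n (\<lambda>xs. \<Sum>j<a xs. f j)"
proof -
  have "prim_rec2 (\<lambda>x y. f x)"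
    by (intro prim_rec_on_compose1[OF assms(1)] prim_rec_on_arith) simp
  from prim_rec_on_compose2[OF prim_rec2_sum[OF this] assms(2,2)] show ?thesis .
qed

lemma prim_rec2_funpow:
  assumes "prim_rec1 f"
  shows "prim_rec2 (\<lambda>j x. (f ^^ j) x)"
proof -
  have "prim_rec2 (\<lambda>j x. rec_nat x (\<lambda>k r. f r) j)"
    by (intro prim_rec2_rec_nat prim_rec_on_intros prim_rec_on_compose1[OF assms]) simp_all
  moreover have "rec_nat x (\<lambda>k r. f r) j = (f ^^ j) x" for x j
    by (induction j) simp_all
  ultimately show ?thesis by simp
qed

lemma prim_rec3_funpow:
  assumes "prim_rec2 f"
  shows "prim_rec3 (\<lambda>j y x. (f y ^^ j) x)"
proof -
  have "prim_rec3 (\<lambda>j y x. rec_nat x (\<lambda>k r. f y r) j)"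
    by (intro prim_rec3_rec_nat prim_rec_on_intros prim_rec_on_compose2[OF assms]) simp_all
  moreover have "rec_nat x (\<lambda>k r. f y r) j = (f y ^^ j) x" for x y j
    by (induction j) simp_all
  ultimately show ?thesis by simp
qed

lemma prim_rec1_odd: "prim_rec1 (\<lambda>x. of_bool (odd x))"
proof -
  have "prim_rec1 (rec_nat 0 (\<lambda>k r. 1 - r))"
    by (intro prim_rec1_rec_nat prim_rec_on_arith) simp
  moreover have "rec_nat (0::nat) (\<lambda>k r. 1 - r) x = of_bool (odd x)" for x :: nat
    by (induction x) simp_all
  ultimately show ?thesis by simp
qed

lemma prim_rec1_even: "prim_rec1 (\<lambda>x. of_bool (even x))"
  using prim_rec_on_not[OF prim_rec1_odd] by simp

text \<open>
  Half of \<open>x\<close> is the number of odd numbers below \<open>x\<close>, which avoids a recursion for division.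
\<close>

lemma prim_rec1_half: "prim_rec1 (\<lambda>x. x div 2)"
proof -
  have "prim_rec1 (\<lambda>x. \<Sum>j<x. of_bool (odd j))"
    by (intro prim_rec_on_sum[OF prim_rec1_odd] prim_rec_on_intros) simp
  moreover have "(\<Sum>j<x. of_bool (odd j)) = x div 2" for x :: nat
    by (induction x) (auto elim!: oddE evenE)
  ultimately show ?thesis by simp
qed

section \<open>A fast-growing hierarchy\<close>

text \<open>
  A variant of the Ackermann function. Level \<open>k + 1\<close> iterates level \<open>k\<close> from \<open>t + 1\<close>, and not from
  \<open>t\<close>, because the machine below spends one unit of time on unfolding an entry; with this offset
  \<open>fast k t\<close> is exactly the time at which it finishes an entry \<open>k\<close> that it starts at time \<open>t\<close>.
\<close>

primrec fast :: "nat \<Rightarrow> nat \<Rightarrow> nat" where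
  "fast 0 t = Suc t"
| "fast (Suc k) t = (fast k ^^ Suc t) (Suc t)"

lemma funpow_ge:
  assumes "\<And>x. x < f x"
  shows "(x::nat) + n \<le> (f ^^ n) x"
proof (induction n)
  case (Suc n)
  then show ?case using assms[of "(f ^^ n) x"] by simp
qed simp

lemma fast_gt: "t < fast k t"
proof (induction k arbitrary: t)
  case (Suc k)
  then show ?case using funpow_ge[of "fast k" "Suc t" "Suc t"] by (simp del: funpow.simps)
qed simp

lemma funpow_le_funpow:
  assumes "mono (f::nat\<Rightarrow>nat)" "\<And>x. x < f x" "x \<le> y" "m \<le> n"
  shows "(f ^^ m) x \<le> (f ^^ n) y"
proof -
  have "(f ^^ m) x \<le> (f ^^ m) y" using assms by (simp add: funpow_mono)
  also have "\<dots> \<le> (f ^^ (n - m)) ((f ^^ m) y)"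
    using funpow_ge[OF assms(2), of "(f ^^ m) y" "n - m"] by simp
  also have "\<dots> = (f ^^ n) y" using assms(4) by (simp flip: funpow_add[THEN fun_cong, unfolded o_def])
  finally show ?thesis .
qed

lemma strict_mono_fast: "strict_mono (fast k)"
proof (induction k)
  case 0
  then show ?case by (simp add: strict_mono_def)
next
  case (Suc k)
  have "fast (Suc k) t < fast (Suc k) (Suc t)" for t
  proof -
    have "fast (Suc k) t < fast k (fast (Suc k) t)" by (rule fast_gt)
    also have "\<dots> = (fast k ^^ Suc (Suc t)) (Suc t)" by simp
    also have "\<dots> \<le> (fast k ^^ Suc (Suc t)) (Suc (Suc t))"
      by (intro funpow_le_funpow strict_mono_mono Suc.IH fast_gt) simp_all
    finally show ?thesis by simp
  qed
  then show ?case by (simp add: strict_mono_Suc_iff)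
qed

lemma fast_mono: "x \<le> y \<Longrightarrow> fast k x \<le> fast k y"
  using strict_mono_mono[OF strict_mono_fast] by (rule monoD)

lemma fast_level_mono:
  assumes "k \<le> l"
  shows "fast k t \<le> fast l t"
proof -
  have "fast k t \<le> fast (Suc k) t" for k
  proof -
    have "(fast k ^^ 1) t \<le> (fast k ^^ Suc t) (Suc t)"
      by (intro funpow_le_funpow strict_mono_mono strict_mono_fast fast_gt) simp_all
    then show ?thesis by simp
  qed
  then show ?thesis using assms by (rule lift_Suc_mono_le)
qed

lemma fast_le: "k \<le> l \<Longrightarrow> x \<le> y \<Longrightarrow> fast k x \<le> fast l y"
  using fast_mono fast_level_mono le_trans by blast

lemma fast_1: "fast 1 t = 2 * t + 2"
proof -
  have "(fast 0 ^^ n) x = x + n" for n x by (induction n) simp_all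
  then show ?thesis unfolding One_nat_def fast.simps(2) by simp
qed

lemma fast_add: "fast k x + c \<le> fast k (x + c)"
proof (induction c)
  case (Suc c)
  then show ?case using strict_monoD[OF strict_mono_fast[of k], of "x + c" "x + Suc c"] by simp
qed simp

lemma fast_fast: "fast k (fast k x) \<le> fast (Suc k) (Suc x)"
proof -
  have "(fast k ^^ 2) x \<le> (fast k ^^ Suc (Suc x)) (Suc (Suc x))"
    by (intro funpow_le_funpow strict_mono_mono strict_mono_fast fast_gt) simp_all
  then show ?thesis by (simp add: numeral_2_eq_2)
qed

text \<open>
  Two applications of one level are absorbed by a single application of the next. Functions
  bounded by some level with a shifted argument are therefore closed under composition, and, since
  level one more than doubles, under addition.
\<close>

lemma fast_compose_bound:
  obtains m e where "\<And>x. fast k (fast l (x + d) + c) \<le> fast m (x + e)"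
proof
  fix x
  have "fast l (x + d) + c \<le> fast l (x + d + c)" by (rule fast_add)
  then have "fast k (fast l (x + d) + c) \<le> fast (max k l) (fast (max k l) (x + d + c))"
    by (meson fast_le max.cobounded1 max.cobounded2 le_trans order_refl)
  also have "\<dots> \<le> fast (Suc (max k l)) (x + Suc (d + c))"
    using fast_fast[of "max k l" "x + d + c"] by (simp add: add.assoc)
  finally show "fast k (fast l (x + d) + c) \<le> fast (Suc (max k l)) (x + Suc (d + c))" .
qed

lemma fast_add_bound:
  obtains m e where "\<And>x. fast k (x + c) + fast l (x + d) \<le> fast m (x + e)"
proof -
  obtain m e where me: "\<And>x. fast 1 (fast (max k l) (x + max c d) + 0) \<le> fast m (x + e)"
    using fast_compose_bound[where k = 1 and l = "max k l" and c = 0 and d = "max c d"] by blast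
  have "fast k (x + c) + fast l (x + d) \<le> fast m (x + e)" for x
  proof -
    have "fast k (x + c) \<le> fast (max k l) (x + max c d)"
      "fast l (x + d) \<le> fast (max k l) (x + max c d)" by (auto intro: fast_le)
    moreover have "2 * fast (max k l) (x + max c d) + 2 \<le> fast m (x + e)"
      using me[of x] unfolding fast_1 by (simp only: add_0_right)
    ultimately show ?thesis
      unfolding mult_2 by (meson add_leD1 add_mono le_trans)
  qed
  then show ?thesis by (rule that)
qed

text \<open>
  Each step of the recursion enlarges the sum of the index, the value and the parameters by at most
  one application of level \<open>l = k + 2\<close>, so the whole recursion costs at most \<open>i + 1\<close> applications of
  this level, that is, one application of level \<open>k + 3\<close>.
\<close>

lemma rec_nat_fast_bound:
  assumes b: "b \<le> fast k (s + c)" and h: "\<And>i r. h i r \<le> fast k (i + r + s + c)"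
  shows "rec_nat b h i \<le> fast (Suc (Suc (Suc k))) (i + s + Suc c)"
proof -
  define l where "l = Suc (Suc k)"
  have step: "y + fast k y < fast l y" if "y > 0" for y
  proof -
    have "y < fast k y" by (rule fast_gt)
    then have "y + fast k y < fast 1 (fast k y)" unfolding fast_1 by linarith
    also have "\<dots> \<le> fast (Suc k) (fast (Suc k) y)" by (intro fast_le) simp_all
    also have "\<dots> = (fast (Suc k) ^^ 2) y" by (simp only: numeral_2_eq_2 funpow.simps o_def id_apply)
    also have "\<dots> \<le> (fast (Suc k) ^^ Suc y) (Suc y)"
      using that by (intro funpow_le_funpow strict_mono_mono strict_mono_fast fast_gt) simp_all
    also have "\<dots> = fast l y" by (simp only: l_def fast.simps)
    finally show ?thesis .
  qed
  \<comment> \<open>The summand \<open>Suc c\<close> keeps the argument of \<open>step\<close> positive, as it has to be there.\<close>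
  have "i + rec_nat b h i + s + Suc c \<le> (fast l ^^ Suc i) (s + Suc c)"
  proof (induction i)
    case 0
    have "b \<le> fast k (s + Suc c)" using b fast_mono[of "s + c" "s + Suc c" k] by simp
    then show ?case using step[of "s + Suc c"] by simp
  next
    case (Suc i)
    let ?y = "i + rec_nat b h i + s + Suc c"
    have "h i (rec_nat b h i) \<le> fast k ?y"
      using h[of i "rec_nat b h i"] fast_mono[of "i + rec_nat b h i + s + c" ?y k] by simp
    then have "Suc i + rec_nat b h (Suc i) + s + Suc c \<le> fast l ?y"
      using step[of ?y] by simp
    also have "\<dots> \<le> fast l ((fast l ^^ Suc i) (s + Suc c))" by (rule fast_mono[OF Suc.IH])
    finally show ?case by simp
  qed
  then have "rec_nat b h i \<le> (fast l ^^ Suc i) (s + Suc c)" by linarith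
  also have "\<dots> \<le> (fast l ^^ Suc (i + s + Suc c)) (Suc (i + s + Suc c))"
    by (intro funpow_le_funpow strict_mono_mono strict_mono_fast fast_gt) simp_all
  finally show ?thesis by (simp add: l_def)
qed

definition fast_bounded :: "nat \<Rightarrow> (nat list \<Rightarrow> nat) \<Rightarrow> bool" where
  "fast_bounded n f \<longleftrightarrow> (\<exists>k c. \<forall>xs. length xs = n \<longrightarrow> f xs \<le> fast k (sum_list xs + c))"

lemma fast_bounded_sum_list:
  "\<forall>f \<in> set fs. fast_bounded n f \<Longrightarrow> fast_bounded n (\<lambda>xs. sum_list (map (\<lambda>f. f xs) fs))"
proof (induction fs)
  case Nil
  then show ?case by (simp add: fast_bounded_def)
next
  case (Cons f fs)
  then obtain k c l d where
    "\<And>xs. length xs = n \<Longrightarrow> f xs \<le> fast k (sum_list xs + c)"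
    "\<And>xs. length xs = n \<Longrightarrow> sum_list (map (\<lambda>f. f xs) fs) \<le> fast l (sum_list xs + d)"
    unfolding fast_bounded_def by (auto simp: fast_bounded_def)
  note bounds = this
  obtain m e where me: "\<And>x. fast k (x + c) + fast l (x + d) \<le> fast m (x + e)"
    using fast_add_bound[where k = k and l = l and c = c and d = d] by blast
  have "f xs + sum_list (map (\<lambda>f. f xs) fs) \<le> fast m (sum_list xs + e)"
    if "length xs = n" for xs using that by (intro le_trans[OF add_mono[OF bounds] me])
  then show ?case unfolding fast_bounded_def by auto
qed

text \<open>
  The Ackermann-style majorization theorem, by induction on the construction of \<open>f\<close>. The shift by a
  constant \<open>c\<close> in the bound is what makes it survive sums and compositions without a requirement
  that the arguments be large.
\<close>

lemma prim_rec_fast_bounded: "prim_rec n f \<Longrightarrow> fast_bounded n f"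
proof (induction rule: prim_rec.induct)
  case (zero n)
  then show ?case by (simp add: fast_bounded_def)
next
  case succ
  have "Suc (xs ! 0) \<le> fast 0 (sum_list xs + 0)" if "length xs = 1" for xs
    using that by (auto simp: length_Suc_conv)
  then show ?case unfolding fast_bounded_def by blast
next
  case (proj i n)
  have "xs ! i \<le> fast 0 (sum_list xs + 0)" if "length xs = n" for xs
    using proj that elem_le_sum_list[of i xs] by simp
  then show ?case unfolding fast_bounded_def by blast
next
  case (comp fs g n)
  then have "fast_bounded n (\<lambda>xs. sum_list (map (\<lambda>f. f xs) fs))"
    by (intro fast_bounded_sum_list) simp
  then obtain l d where
    l: "\<And>xs. length xs = n \<Longrightarrow> sum_list (map (\<lambda>f. f xs) fs) \<le> fast l (sum_list xs + d)"
    unfolding fast_bounded_def by blast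
  obtain k c where k: "\<And>ys. length ys = length fs \<Longrightarrow> g ys \<le> fast k (sum_list ys + c)"
    using comp.IH unfolding fast_bounded_def by blast
  obtain m e where me: "\<And>x. fast k (fast l (x + d) + c) \<le> fast m (x + e)"
    using fast_compose_bound[where k = k and l = l and c = c and d = d] by blast
  have "g (map (\<lambda>f. f xs) fs) \<le> fast m (sum_list xs + e)" if "length xs = n" for xs
  proof -
    have "g (map (\<lambda>f. f xs) fs) \<le> fast k (sum_list (map (\<lambda>f. f xs) fs) + c)"
      by (rule k) simp
    also have "\<dots> \<le> fast k (fast l (sum_list xs + d) + c)"
      using l[OF that] by (intro fast_mono) simp
    also have "\<dots> \<le> fast m (sum_list xs + e)" by (rule me)
    finally show ?thesis .
  qed
  then show ?case unfolding fast_bounded_def by blast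
next
  case (prec n g h)
  obtain k c where g: "\<And>xs. length xs = n \<Longrightarrow> g xs \<le> fast k (sum_list xs + c)"
    using prec.IH(1) unfolding fast_bounded_def by blast
  obtain l d where h: "\<And>xs. length xs = n + 2 \<Longrightarrow> h xs \<le> fast l (sum_list xs + d)"
    using prec.IH(2) unfolding fast_bounded_def by blast
  let ?m = "max k l" and ?e = "max c d"
  have "rec_nat (g (tl xs)) (\<lambda>k r. h (k # r # tl xs)) (hd xs)
      \<le> fast (Suc (Suc (Suc ?m))) (sum_list xs + Suc ?e)" if "length xs = n + 1" for xs
  proof -
    obtain i ys where xs: "xs = i # ys" "length ys = n"
      using \<open>length xs = n + 1\<close> by (auto simp: length_Suc_conv)
    have "g ys \<le> fast ?m (sum_list ys + ?e)"
      using g[OF xs(2)] by (rule le_trans) (auto intro: fast_le)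
    moreover have "h (i # r # ys) \<le> fast ?m (i + r + sum_list ys + ?e)" for i r
    proof -
      have "h (i # r # ys) \<le> fast l (sum_list (i # r # ys) + d)" using xs by (intro h) simp
      also have "\<dots> \<le> fast ?m (i + r + sum_list ys + ?e)" by (intro fast_le) simp_all
      finally show ?thesis .
    qed
    ultimately have "rec_nat (g ys) (\<lambda>k r. h (k # r # ys)) i
        \<le> fast (Suc (Suc (Suc ?m))) (i + sum_list ys + Suc ?e)"
      by (rule rec_nat_fast_bound)
    then show ?thesis by (simp add: xs del: fast.simps)
  qed
  then show ?case unfolding fast_bounded_def by blast
qed

lemma prim_rec_fun_fast_bound:
  assumes "prim_rec_fun f"
  obtains k c where "\<And>x. f x \<le> fast k (x + c)"
proof -
  obtain g where g: "prim_rec 1 g" "\<And>x. g [x] = f x"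
    using assms unfolding prim_rec_fun_def by blast
  obtain k c where kc: "\<And>xs. length xs = 1 \<Longrightarrow> g xs \<le> fast k (sum_list xs + c)"
    using prim_rec_fast_bounded[OF g(1)] unfolding fast_bounded_def by blast
  then have "f x \<le> fast k (x + c)" for x using kc[of "[x]"] g(2)[of x] by simp
  then show ?thesis by (rule that)
qed

section \<open>A primitive recursive clock\<close>

text \<open>
  A stack of natural numbers is coded by a single number, \<open>0\<close> being the empty stack and \<open>push m r\<close>
  the stack with top \<open>m\<close> and rest \<open>r\<close>: the top entry is the exponent of two in the code.
\<close>

definition push :: "nat \<Rightarrow> nat \<Rightarrow> nat" where
  "push m r = 2 ^ m * (2 * r + 1)"

definition halve_even :: "nat \<Rightarrow> nat" where
  "halve_even s = (if odd s then s else s div 2)"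

text \<open>
  The exponent of two in \<open>s\<close> is less than \<open>s\<close>, so \<open>s\<close> rounds of halving are enough to determine it
  and to reach the odd part.
\<close>

definition top_of :: "nat \<Rightarrow> nat" where
  "top_of s = (\<Sum>j<s. of_bool (even ((halve_even ^^ j) s)))"

definition rest_of :: "nat \<Rightarrow> nat" where
  "rest_of s = (halve_even ^^ s) s div 2"

text \<open>
  An entry \<open>m + 1\<close> on top is replaced by \<open>t + 1\<close> entries \<open>m\<close>, an entry \<open>0\<close> is removed, and an empty
  stack receives a new entry. The time \<open>t\<close> itself serves as the argument that is being increased, so
  the machine needs no register besides its stack, and its history is a recursion on single numbers.
\<close>

definition step :: "nat \<Rightarrow> nat \<Rightarrow> nat" where
  "step t s = (if s = 0 then push t 0
    else if top_of s = 0 then rest_of s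
    else (push (top_of s - 1) ^^ Suc t) (rest_of s))"

primrec state :: "nat \<Rightarrow> nat" where
  "state 0 = 0"
| "state (Suc t) = step t (state t)"

lemma push_pos: "push m r > 0"
  by (simp add: push_def)

lemma halve_even_funpow_push: "(halve_even ^^ j) (push m r) = push (m - j) r"
proof (induction j)
  case (Suc j)
  then show ?case
    by (cases "m - j") (auto simp: halve_even_def push_def Suc_diff_Suc diff_Suc split: nat.splits)
qed simp

lemma level_less_push: "m < push m r"
proof -
  have "m < 2 ^ m" by simp
  also have "\<dots> \<le> push m r" unfolding push_def by simp
  finally show ?thesis .
qed

lemma top_of_push: "top_of (push m r) = m"
proof -
  have "even (push j r) \<longleftrightarrow> j > 0" for j by (cases j) (auto simp: push_def)
  then have "top_of (push m r) = card {j. j < push m r \<and> j < m}"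
    by (simp add: top_of_def halve_even_funpow_push of_bool_def sum.If_cases Int_def lessThan_def)
  also have "{j. j < push m r \<and> j < m} = {..<m}" using level_less_push[of m r] by auto
  finally show ?thesis by simp
qed

lemma rest_of_push: "rest_of (push m r) = r"
  using level_less_push[of m r] by (simp add: rest_of_def halve_even_funpow_push) (simp add: push_def)

lemma step_push_0: "step t (push 0 r) = r"
  using push_pos[of 0 r] by (simp add: step_def top_of_push rest_of_push)

lemma step_push_Suc: "step t (push (Suc m) r) = (push m ^^ Suc t) r"
  using push_pos[of "Suc m" r] by (simp add: step_def top_of_push rest_of_push)

lemma prim_rec1_state: "prim_rec1 state"
proof -
  have "prim_rec2 (\<lambda>m r. rec_nat (2 * r + 1) (\<lambda>k s. 2 * s) m)"
    by (intro prim_rec2_rec_nat prim_rec_on_arith) simp_all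
  moreover have "rec_nat (2 * r + 1) (\<lambda>k s. 2 * s) m = push m r" for m r
    by (induction m) (simp_all add: push_def)
  ultimately have push: "prim_rec2 push" by simp
  have halve: "prim_rec1 halve_even"
    unfolding halve_even_def
    by (intro prim_rec_on_arith prim_rec1_odd prim_rec1_half) simp
  have "prim_rec2 (\<lambda>j s. of_bool (even ((halve_even ^^ j) s)))"
    by (intro prim_rec_on_compose1[OF prim_rec1_even] prim_rec2_funpow halve)
  note sum = prim_rec2_sum[OF this]
  have top: "prim_rec1 top_of"
    unfolding top_of_def by (intro prim_rec_on_compose2[OF sum] prim_rec_on_arith) simp_all
  have rest: "prim_rec1 rest_of"
    unfolding rest_of_def
    by (intro prim_rec_on_compose1[OF prim_rec1_half]
        prim_rec_on_compose2[OF prim_rec2_funpow[OF halve]] prim_rec_on_arith) simp_all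
  have "prim_rec2 step"
    unfolding step_def
    by (intro prim_rec_on_arith prim_rec_on_compose2[OF push] prim_rec_on_compose1[OF top]
        prim_rec_on_compose1[OF rest] prim_rec_on_compose3[OF prim_rec3_funpow[OF push]]) simp_all
  from prim_rec1_rec_nat[OF this] have "prim_rec1 (rec_nat 0 step)" .
  moreover have "rec_nat 0 step = state"
  proof
    fix t show "rec_nat 0 step t = state t" by (induction t) simp_all
  qed
  ultimately show ?thesis by simp
qed

text \<open>
  The requirement that the stack does not become empty before \<open>t'\<close> ensures that no new evaluation
  starts in between. It admits \<open>r = 0\<close>, since only the times before \<open>t'\<close> are concerned.
\<close>

definition returns :: "nat \<Rightarrow> nat \<Rightarrow> nat \<Rightarrow> bool" where
  "returns t t' r \<longleftrightarrow> t \<le> t' \<and> state t' = r \<and> (\<forall>i. t \<le> i \<and> i < t' \<longrightarrow> state i > 0)"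

lemma returns_trans: "returns t t' r \<Longrightarrow> returns t' t'' r' \<Longrightarrow> returns t t'' r'"
  unfolding returns_def by (meson le_trans not_le)

text \<open>
  The entry \<open>0\<close> is removed in one unit of time. The entry \<open>k + 1\<close> unfolds at time \<open>t\<close> into \<open>t + 1\<close>
  entries \<open>k\<close>, which are processed one after the other from time \<open>t + 1\<close> on, each one starting when
  the previous one is finished. This is the recursion that defines \<open>fast\<close>.
\<close>

lemma returns_push: "state t = push k r \<Longrightarrow> returns t (fast k t) r"
proof (induction k arbitrary: t r)
  case 0
  then show ?case using push_pos[of 0 r] by (auto simp: returns_def step_push_0 less_Suc_eq_le dest: le_antisym)
next
  case (Suc k)
  have iter: "returns t ((fast k ^^ j) t) r" if "state t = (push k ^^ j) r" for j t
    using that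
  proof (induction j arbitrary: t)
    case 0
    then show ?case by (simp add: returns_def)
  next
    case (Suc j)
    then have "returns t (fast k t) ((push k ^^ j) r)"
      by (intro \<open>\<And>t r. state t = push k r \<Longrightarrow> _\<close>) simp
    moreover from this have "returns (fast k t) ((fast k ^^ j) (fast k t)) r"
      by (intro Suc.IH) (simp add: returns_def)
    ultimately show ?case unfolding funpow_Suc_right o_def by (rule returns_trans)
  qed
  have "returns t (Suc t) (state (Suc t))"
    using push_pos[of "Suc k" r] Suc.prems by (auto simp: returns_def less_Suc_eq_le dest: le_antisym)
  moreover have "returns (Suc t) (fast (Suc k) t) r"
    unfolding fast.simps using Suc.prems by (intro iter) (simp add: step_push_Suc del: funpow.simps)
  ultimately show ?case by (rule returns_trans)
qed

text \<open>
  The times at which the stack is empty, in increasing order: at such a time \<open>t\<close> the entry \<open>t\<close> is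
  put on the stack, and it is processed from time \<open>t + 1\<close> on.
\<close>

primrec alarm :: "nat \<Rightarrow> nat" where
  "alarm 0 = 0"
| "alarm (Suc u) = fast (alarm u) (Suc (alarm u))"

lemma strict_mono_alarm: "strict_mono alarm"
  unfolding strict_mono_Suc_iff using less_trans[OF lessI fast_gt] by simp

lemma alarm_ge: "u \<le> alarm u"
  using strict_mono_alarm by (rule strict_mono_imp_increasing)

lemma state_alarm: "state (alarm u) = 0"
  and state_between_alarms: "alarm u < t \<Longrightarrow> t < alarm (Suc u) \<Longrightarrow> state t > 0"
proof -
  have step: "returns (Suc (alarm u)) (alarm (Suc u)) 0" if "state (alarm u) = 0" for u
    using that by (simp add: returns_push step_def)
  show zero: "state (alarm u) = 0" for u
    using step by (induction u) (simp_all add: returns_def)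
  show "alarm u < t \<Longrightarrow> t < alarm (Suc u) \<Longrightarrow> state t > 0"
    using step[OF zero, of u] by (simp add: returns_def)
qed

lemma strict_mono_bracket:
  fixes g :: "nat \<Rightarrow> nat"
  assumes "strict_mono g" "g N \<le> t"
  obtains u where "N \<le> u" "g u \<le> t" "t < g (Suc u)"
proof -
  let ?v = "LEAST v. t < g v"
  have "t < g (Suc t)" using strict_mono_imp_increasing[OF assms(1), of "Suc t"] by simp
  then have v: "t < g ?v" by (rule LeastI)
  with assms(2) have "g N < g ?v" by simp
  then have N: "N < ?v" using strict_mono_less[OF assms(1)] by blast
  then obtain u where u: "?v = Suc u" by (cases ?v) simp_all
  then have "\<not> t < g u" by (intro not_less_Least) simp
  with u v N show ?thesis by (intro that[of u]) simp_all
qed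

lemma state_eq_0_iff: "state t = 0 \<longleftrightarrow> t \<in> range alarm"
proof
  assume "state t = 0"
  obtain u where u: "alarm u \<le> t" "t < alarm (Suc u)"
    using strict_mono_bracket[OF strict_mono_alarm, of 0 t] by auto
  then have "t = alarm u" using state_between_alarms[of u t] \<open>state t = 0\<close> by force
  then show "t \<in> range alarm" by simp
qed (auto simp: state_alarm)

text \<open>
  This counting function inverts \<open>alarm\<close> on its range and is primitive recursive, although \<open>alarm\<close>
  itself is not.
\<close>

definition alarms_before :: "nat \<Rightarrow> nat" where
  "alarms_before x = (\<Sum>t<x. of_bool (state t = 0))"

lemma prim_rec1_alarms_before: "prim_rec1 alarms_before"
  unfolding alarms_before_def
  by (intro prim_rec_on_sum prim_rec_on_arith prim_rec1_state) simp

lemma alarms_before_alarm: "alarms_before (alarm u) = u"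
proof -
  have "alarms_before (alarm u) = card {t. t < alarm u \<and> t \<in> range alarm}"
    by (simp add: alarms_before_def of_bool_def sum.If_cases Int_def lessThan_def state_eq_0_iff)
  also have "{t. t < alarm u \<and> t \<in> range alarm} = alarm ` {..<u}"
    using strict_mono_less[OF strict_mono_alarm] by auto
  also have "card \<dots> = u"
    using strict_mono_imp_inj_on[OF strict_mono_alarm] by (simp add: card_image inj_on_subset)
  finally show ?thesis .
qed

lemma in_alarm_image_iff: "x \<in> alarm ` E \<longleftrightarrow> state x = 0 \<and> alarms_before x \<in> E"
  by (auto simp: state_eq_0_iff alarms_before_alarm)

text \<open>
  The value \<open>alarm (Suc u)\<close> comes from the level \<open>alarm u\<close>, which is at least \<open>u\<close> and so exceeds
  the fixed level \<open>k\<close> once \<open>u\<close> does. One more level beats the shift of the argument by \<open>c\<close>, since iterating \<open>fast k\<close>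
  for \<open>u + 1\<close> times adds at least \<open>u + 1\<close>.
\<close>

lemma alarm_dominates:
  obtains N where "\<And>u. u \<ge> N \<Longrightarrow> fast k (u + c) < alarm (Suc u)"
proof
  fix u assume u: "u \<ge> max (Suc k) c"
  have "fast k (u + c) < fast k ((fast k ^^ Suc u) (Suc (Suc u)))"
    using funpow_ge[of "fast k" "Suc (Suc u)" "Suc u", OF fast_gt] u
    by (intro strict_monoD[OF strict_mono_fast]) simp
  also have "\<dots> = fast (Suc k) (Suc u)" by simp
  also have "\<dots> \<le> alarm (Suc u)"
    unfolding alarm.simps using alarm_ge[of u] u by (intro fast_le) simp_all
  finally show "fast k (u + c) < alarm (Suc u)" .
qed

section \<open>Reductions and counting\<close>

lemma count_zeros_mono: "s \<le> t \<Longrightarrow> count_zeros U s \<le> count_zeros U t"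
  unfolding count_zeros_def by (rule card_mono) auto

lemma count_zeros_Suc: "count_zeros U (Suc s) = count_zeros U s + of_bool (Suc s \<notin> U)"
proof -
  have "{i. i \<le> Suc s \<and> i \<notin> U} = (if Suc s \<in> U then {} else {Suc s}) \<union> {i. i \<le> s \<and> i \<notin> U}"
    by (auto simp: le_Suc_eq)
  then show ?thesis by (simp add: count_zeros_def)
qed

lemma count_zeros_0: "count_zeros U 0 = of_bool (0 \<notin> U)"
proof -
  have "{i. i \<le> 0 \<and> i \<notin> U} = (if 0 \<in> U then {} else {0::nat})" by (auto intro: gr0I)
  then show ?thesis by (simp add: count_zeros_def)
qed

lemma count_zeros_eq_sum: "count_zeros U s = (\<Sum>i<Suc s. of_bool (i \<notin> U))"
  by (induction s) (simp_all add: count_zeros_Suc count_zeros_0)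

lemma count_zeros_unbounded:
  assumes "infinite (- U)"
  obtains N where "\<And>t. t \<ge> N \<Longrightarrow> n \<le> count_zeros U t"
proof -
  obtain A where A: "A \<subseteq> - U" "finite A" "card A = n"
    using infinite_arbitrarily_large[OF assms] by blast
  obtain N where N: "\<forall>a\<in>A. a \<le> N" using A(2) finite_nat_set_iff_bounded_le by blast
  have "n \<le> count_zeros U t" if "t \<ge> N" for t
    unfolding count_zeros_def A(3)[symmetric] using A N that
    by (intro card_mono) (auto intro: le_trans)
  then show ?thesis by (rule that)
qed

text \<open>
  A reduction separates the zeros of \<open>U\<close> from each other. Hence at most one of them can be sent into
  the class \<open>V\<close>, and the others go to different zeros of \<open>V\<close>. The images of numbers up to \<open>s\<close> stay
  below a level of the hierarchy, which unlike the reduction itself is monotone.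
\<close>

lemma pr_le_count_zeros:
  assumes "one_class_rel U \<le>pr one_class_rel V"
  obtains k c where "\<And>s. count_zeros U s \<le> count_zeros V (fast k (s + c)) + 1"
proof -
  obtain f where f: "prim_rec_fun f"
    "\<And>x y. (x, y) \<in> one_class_rel U \<longleftrightarrow> (f x, f y) \<in> one_class_rel V"
    using assms unfolding pr_le_def by blast
  obtain k c where kc: "\<And>x. f x \<le> fast k (x + c)"
    using prim_rec_fun_fast_bound[OF f(1)] by blast
  have "count_zeros U s \<le> count_zeros V (fast k (s + c)) + 1" for s
  proof -
    let ?A = "{i. i \<le> s \<and> i \<notin> U}" and ?B = "{i. i \<le> fast k (s + c) \<and> i \<notin> V}"
    have sep: "x = y" if "x \<in> ?A" "y \<in> ?A" "f x = f y \<or> f x \<in> V \<and> f y \<in> V" for x y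
      using that f(2)[of x y] by (auto simp: one_class_rel_def)
    have "card {x \<in> ?A. f x \<in> V} \<le> 1"
      using sep by (auto simp: card_le_Suc0_iff_eq)
    moreover have "card {x \<in> ?A. f x \<notin> V} \<le> card ?B"
    proof (rule card_inj_on_le)
      show "inj_on f {x \<in> ?A. f x \<notin> V}" using sep by (auto intro: inj_onI)
      show "f ` {x \<in> ?A. f x \<notin> V} \<subseteq> ?B"
        using le_trans[OF kc fast_mono] by auto
    qed simp
    moreover have "?A = {x \<in> ?A. f x \<in> V} \<union> {x \<in> ?A. f x \<notin> V}" by auto
    then have "card ?A \<le> card {x \<in> ?A. f x \<in> V} + card {x \<in> ?A. f x \<notin> V}"
      by (metis (no_types, lifting) card_Un_le)
    ultimately show ?thesis unfolding count_zeros_def by linarith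
  qed
  then show ?thesis by (rule that)
qed

lemma equiv_one_class_rel: "equiv UNIV (one_class_rel X)"
  by (auto simp: one_class_rel_def equiv_def refl_on_def sym_def trans_def)

lemma quotient_one_class_rel_subset:
  "UNIV // one_class_rel X \<subseteq> insert X ((\<lambda>x. {x}) ` (- X))"
  by (auto simp: quotient_def one_class_rel_def)

lemma infinite_quotient_one_class_rel_iff:
  "infinite (UNIV // one_class_rel X) \<longleftrightarrow> infinite (- X)"
proof
  assume "infinite (UNIV // one_class_rel X)"
  then show "infinite (- X)"
    using quotient_one_class_rel_subset[of X] by (meson finite_imageI finite_insert finite_subset)
next
  assume "infinite (- X)"
  moreover have "(\<lambda>x. {x}) ` (- X) \<subseteq> UNIV // one_class_rel X"
    by (auto simp: quotient_def one_class_rel_def)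
  ultimately show "infinite (UNIV // one_class_rel X)"
    by (meson finite_imageD finite_subset inj_onI singleton_inject)
qed

lemma punctual_one_class_rel:
  assumes "prim_rec_set X" "infinite (- X)"
  shows "punctual (one_class_rel X)"
proof -
  note X = assms(1)[unfolded prim_rec_set_iff]
  have "prim_rec2 (\<lambda>x y. of_bool (x \<in> X \<and> y \<in> X \<or> x = y))"
    by (intro prim_rec_on_arith prim_rec_on_compose1[OF X]) simp_all
  then obtain g where "prim_rec 2 g"
    "\<And>xs. length xs = 2 \<Longrightarrow> g xs = of_bool (xs ! 0 \<in> X \<and> xs ! 1 \<in> X \<or> xs ! 0 = xs ! 1)"
    unfolding prim_rec_on_def by blast
  then have "prim_rec_rel (one_class_rel X)"
    unfolding prim_rec_rel_def by (intro exI[of _ g]) (simp add: one_class_rel_def)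
  then show ?thesis
    unfolding punctual_def infinite_quotient_one_class_rel_iff
    using assms(2) equiv_one_class_rel by blast
qed

section \<open>The sparse set\<close>

text \<open>
  Zeros are numbered from one, so the least zero of \<open>Y\<close> has an odd number and is left out. It serves
  as the image of the large class in \<open>sparse_pr_le\<close>.
\<close>

definition alternate_zeros :: "nat set \<Rightarrow> nat set" where
  "alternate_zeros Y = {u. u \<notin> Y \<and> even (count_zeros Y u)}"

lemma card_alternate_zeros: "card (alternate_zeros Y \<inter> {..u}) = count_zeros Y u div 2"
proof (induction u)
  case 0
  have "alternate_zeros Y \<inter> {..0} = {}"
    by (auto simp: alternate_zeros_def count_zeros_0)
  then show ?case by (simp add: count_zeros_0)
next
  case (Suc u)
  have "alternate_zeros Y \<inter> {..Suc u}
      = (if Suc u \<in> alternate_zeros Y then {Suc u} else {}) \<union> (alternate_zeros Y \<inter> {..u})"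
    by (auto simp: le_Suc_eq)
  then have "card (alternate_zeros Y \<inter> {..Suc u})
      = of_bool (Suc u \<in> alternate_zeros Y) + count_zeros Y u div 2"
    using Suc.IH by simp
  then show ?case by (auto simp: alternate_zeros_def count_zeros_Suc elim!: oddE evenE)
qed

lemma infinite_alternate_zeros:
  assumes "infinite (- Y)"
  shows "infinite (alternate_zeros Y)"
proof
  assume fin: "finite (alternate_zeros Y)"
  obtain N where "\<And>t. t \<ge> N \<Longrightarrow> 2 * Suc (card (alternate_zeros Y)) \<le> count_zeros Y t"
    using count_zeros_unbounded[OF assms, where n = "2 * Suc (card (alternate_zeros Y))"] by blast
  from this[of N] have "card (alternate_zeros Y) < card (alternate_zeros Y \<inter> {..N})"
    by (simp add: card_alternate_zeros)
  also have "\<dots> \<le> card (alternate_zeros Y)" using fin by (intro card_mono) auto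
  finally show False by simp
qed

definition sparse :: "nat set \<Rightarrow> nat set" where
  "sparse Y = - (alarm ` alternate_zeros Y)"

lemma infinite_Compl_sparse:
  assumes "infinite (- Y)"
  shows "infinite (- sparse Y)"
  using infinite_alternate_zeros[OF assms] strict_mono_imp_inj_on[OF strict_mono_alarm]
  by (simp add: sparse_def finite_image_iff inj_on_subset)

lemma prim_rec_set_sparse:
  assumes "prim_rec_set Y"
  shows "prim_rec_set (sparse Y)"
proof -
  note Y = assms[unfolded prim_rec_set_iff]
  have "prim_rec1 (\<lambda>s. \<Sum>i<Suc s. of_bool (i \<notin> Y))"
    by (intro prim_rec_on_sum prim_rec_on_arith Y) simp
  then have count: "prim_rec1 (count_zeros Y)" by (simp only: count_zeros_eq_sum)
  have "prim_rec1 (\<lambda>u. of_bool (u \<notin> Y \<and> even (count_zeros Y u)))"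
    by (intro prim_rec_on_arith Y prim_rec_on_compose1[OF prim_rec1_even] count)
  then have alt: "prim_rec1 (\<lambda>u. of_bool (u \<in> alternate_zeros Y))"
    by (simp add: alternate_zeros_def)
  have "prim_rec1 (\<lambda>x. of_bool (\<not> (state x = 0 \<and> alarms_before x \<in> alternate_zeros Y)))"
    by (intro prim_rec_on_arith prim_rec1_state prim_rec_on_compose1[OF alt]
        prim_rec1_alarms_before)
  then show ?thesis
    unfolding prim_rec_set_iff by (simp only: sparse_def Compl_iff in_alarm_image_iff)
qed

text \<open>
  The zero \<open>alarm u\<close> is sent to \<open>u\<close>. The large class is sent to the least zero of \<open>Y\<close>, which is not
  in \<open>alternate_zeros Y\<close>; a zero rather than an element of \<open>Y\<close> is chosen because \<open>Y\<close> may be empty.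
\<close>

lemma sparse_pr_le:
  assumes "prim_rec_set Y" "infinite (- Y)"
  shows "one_class_rel (sparse Y) \<le>pr one_class_rel Y"
proof -
  note X = prim_rec_set_sparse[OF assms(1), unfolded prim_rec_set_iff]
  define c where "c = (LEAST u. u \<notin> Y)"
  have "\<exists>u. u \<notin> Y" using assms(2) by (metis Compl_iff finite.emptyI equals0I)
  then have c: "c \<notin> Y" unfolding c_def by (rule LeastI_ex)
  have "c \<le> u" if "u \<notin> Y" for u unfolding c_def using that by (rule Least_le)
  then have "{i. i \<le> c \<and> i \<notin> Y} = {c}" using c by (auto intro: le_antisym)
  then have c_alt: "c \<notin> alternate_zeros Y" by (simp add: alternate_zeros_def count_zeros_def)
  define f where "f x = (if x \<in> sparse Y then c else alarms_before x)" for x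
  have "prim_rec_fun f"
    unfolding prim_rec_fun_iff f_def by (intro prim_rec_on_arith X prim_rec1_alarms_before)
  moreover have "(x, y) \<in> one_class_rel (sparse Y) \<longleftrightarrow> (f x, f y) \<in> one_class_rel Y" for x y
  proof -
    have sparse: "x \<in> sparse Y \<and> f x = c \<or> x \<notin> sparse Y \<and> x = alarm (f x) \<and> f x \<in> alternate_zeros Y" for x
      by (auto simp: f_def sparse_def alarms_before_alarm)
    have "alternate_zeros Y \<inter> Y = {}" by (auto simp: alternate_zeros_def)
    then show ?thesis using sparse[of x] sparse[of y] c c_alt
      by (auto simp: one_class_rel_def)
  qed
  ultimately show ?thesis unfolding pr_le_def by blast
qed

lemma count_zeros_sparse:
  assumes "t < alarm (Suc u)"
  shows "2 * count_zeros (sparse Y) t \<le> count_zeros Y u"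
proof -
  have "{i. i \<le> t \<and> i \<notin> sparse Y} \<subseteq> alarm ` (alternate_zeros Y \<inter> {..u})"
  proof
    fix i assume "i \<in> {i. i \<le> t \<and> i \<notin> sparse Y}"
    then obtain v where v: "i = alarm v" "v \<in> alternate_zeros Y" "alarm v \<le> t"
      by (auto simp: sparse_def)
    then have "v < Suc u"
      using assms strict_mono_less[OF strict_mono_alarm, of v "Suc u"] by simp
    with v show "i \<in> alarm ` (alternate_zeros Y \<inter> {..u})" by auto
  qed
  then have "count_zeros (sparse Y) t \<le> card (alternate_zeros Y \<inter> {..u})"
    unfolding count_zeros_def by (rule surj_card_le[rotated]) simp
  then show ?thesis by (simp add: card_alternate_zeros)
qed

lemma sparse_count_zeros_fast:
  obtains N where "\<And>u. u \<ge> N \<Longrightarrow> 2 * count_zeros (sparse Y) (fast k (u + c)) \<le> count_zeros Y u"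
  using alarm_dominates[of k c] count_zeros_sparse by metis

lemma not_pr_le_sparse:
  assumes "infinite (- Y)"
  shows "\<not> one_class_rel Y \<le>pr one_class_rel (sparse Y)"
proof
  assume "one_class_rel Y \<le>pr one_class_rel (sparse Y)"
  then obtain k c where
    le: "\<And>s. count_zeros Y s \<le> count_zeros (sparse Y) (fast k (s + c)) + 1"
    using pr_le_count_zeros by blast
  obtain N where N: "\<And>u. u \<ge> N \<Longrightarrow> 2 * count_zeros (sparse Y) (fast k (u + c)) \<le> count_zeros Y u"
    using sparse_count_zeros_fast[where Y = Y and k = k and c = c] by blast
  obtain M where M: "\<And>u. u \<ge> M \<Longrightarrow> 3 \<le> count_zeros Y u"
    using count_zeros_unbounded[OF assms] by blast
  show False using le[of "max N M"] N[of "max N M"] M[of "max N M"] by simp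
qed

text \<open>
  Let \<open>g u\<close> be the time by which \<open>Y'\<close> has, up to one, as many zeros as \<open>Y\<close> has up to \<open>u\<close>. For a large
  time \<open>t\<close> take \<open>u\<close> with \<open>g u \<le> t < g (u + 1)\<close>. Then \<open>Y'\<close> has nearly as many zeros up to \<open>t\<close> as \<open>Y\<close> has up
  to \<open>u\<close>. On the other hand \<open>X'\<close> has up to \<open>t\<close> at most one zero more than \<open>sparse Y\<close> has up to a
  fast-growing function of \<open>t\<close>; this function of \<open>t < g (u + 1)\<close> is bounded by a fixed level at
  \<open>u\<close>, so that the number is at most about half of the number of zeros of \<open>Y\<close> up to \<open>u\<close>.
\<close>

lemma not_black_lozenge_sparse:
  assumes "infinite (- Y)"
  shows "\<not> black_lozenge (sparse Y) Y"
proof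
  assume "black_lozenge (sparse Y) Y"
  then obtain X' Y' where
    X': "one_class_rel X' \<le>pr one_class_rel (sparse Y)" and
    Y': "one_class_rel Y \<le>pr one_class_rel Y'" and
    eq: "\<And>s. \<exists>t\<ge>s. count_zeros X' t = count_zeros Y' t"
    unfolding black_lozenge_def pr_equiv_def by blast
  obtain k c where kc: "\<And>s. count_zeros X' s \<le> count_zeros (sparse Y) (fast k (s + c)) + 1"
    using pr_le_count_zeros[OF X'] by blast
  obtain l d where ld: "\<And>s. count_zeros Y s \<le> count_zeros Y' (fast l (s + d)) + 1"
    using pr_le_count_zeros[OF Y'] by blast
  obtain m e where me: "\<And>u. fast k (fast l (u + Suc d) + c) \<le> fast m (u + e)"
    using fast_compose_bound[where k = k and l = l and c = c and d = "Suc d"] by blast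
  obtain N where N: "\<And>u. u \<ge> N \<Longrightarrow> 2 * count_zeros (sparse Y) (fast m (u + e)) \<le> count_zeros Y u"
    using sparse_count_zeros_fast[where Y = Y and k = m and c = e] by blast
  \<comment> \<open>If \<open>n\<close> is the number of zeros of \<open>Y\<close> up to \<open>u\<close>, then equal counts give \<open>n - 1 \<le> n / 2 + 1\<close>, which fails
    from \<open>n = 5\<close> on.\<close>
  obtain M where M: "\<And>u. u \<ge> M \<Longrightarrow> 5 \<le> count_zeros Y u"
    using count_zeros_unbounded[OF assms] by blast
  obtain t where t: "fast l (max N M + d) \<le> t" "count_zeros X' t = count_zeros Y' t"
    using eq by blast
  have "strict_mono (\<lambda>u. fast l (u + d))"
    using strict_mono_fast[of l] by (simp add: strict_mono_def)
  from strict_mono_bracket[OF this t(1)] obtain u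
    where u: "max N M \<le> u" "fast l (u + d) \<le> t" and "t < fast l (u + Suc d)"
    by auto
  then have "fast k (t + c) \<le> fast k (fast l (u + Suc d) + c)" by (intro fast_mono) simp
  also have "\<dots> \<le> fast m (u + e)" by (rule me)
  finally have "count_zeros X' t \<le> count_zeros (sparse Y) (fast m (u + e)) + 1"
    using kc[of t] count_zeros_mono[of "fast k (t + c)" "fast m (u + e)" "sparse Y"] by simp
  moreover have "count_zeros Y u \<le> count_zeros Y' t + 1"
    using ld[of u] count_zeros_mono[OF u(2), of Y'] by simp
  ultimately show False
    using N[of u] M[of u] u(1) t(2) by simp
qed

theorem proposition9p7:
  fixes Y :: "nat set"
  assumes "prim_rec_set Y" and "punctual (one_class_rel Y)"
  shows "\<exists>X. prim_rec_set X \<and> punctual (one_class_rel X) \<and>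
             one_class_rel X <pr one_class_rel Y \<and> \<not> black_lozenge X Y"
proof (intro exI conjI)
  have Y: "infinite (- Y)"
    using assms(2) unfolding punctual_def infinite_quotient_one_class_rel_iff by blast
  show "prim_rec_set (sparse Y)" using assms(1) by (rule prim_rec_set_sparse)
  then show "punctual (one_class_rel (sparse Y))"
    using infinite_Compl_sparse[OF Y] by (rule punctual_one_class_rel)
  show "one_class_rel (sparse Y) <pr one_class_rel Y"
    unfolding pr_less_def using sparse_pr_le[OF assms(1) Y] not_pr_le_sparse[OF Y] by blast
  show "\<not> black_lozenge (sparse Y) Y" using Y by (rule not_black_lozenge_sparse)
qed

end
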